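(* Let $i\in\{1,2,3\}$ be given. If $\tilde{\mathbf U}=(\tilde D,\tilde{\mathbf m},\tilde{\mathbf B},\tilde E)^\top\in\mathcal G$ and $\hat{\mathbf U}=(\hat D,\hat{\mathbf m},\hat{\mathbf B},\hat E)^\top\in\mathcal G$ satisfy the 1D "discrete divergence-free" condition $$\tilde B_i-\hat B_i=0,$$ then for any $\alpha\ge c=1$, $$\frac12\Big(\tilde{\mathbf U}-\alpha^{-1}\mathbf F_i(\tilde{\mathbf U})+\hat{\mathbf U}+\alpha^{-1}\mathbf F_i(\hat{\mathbf U})\Big)\in\mathcal G.$$
   Context: Fix the adiabatic index $\Gamma\in(1,2]$ (equation of state $p=(\Gamma-1)\rho e$; speed of light $c=1$). For primitive variables $\mathbf V=(\rho,\mathbf v,\mathbf B,p)$ with $\rho,p>0$, $\mathbf v,\mathbf B\in\mathbb R^3$, $|\mathbf v|<1$, put $W=(1-|\mathbf v|^2)^{-1/2}$, $e=\frac{p}{(\Gamma-1)\rho}$, $h=1+e+\frac p\rho$, $p_m=\frac12\big(W^{-2}|\mathbf B|^2+(\mathbf v\cdot\mathbf B)^2\big)$, $p_{tot}=p+p_m$. The associated conservative vector is $\mathbf U(\mathbf V)=(D,\mathbf m,\mathbf B,E)^\top\in\mathbb R^8$ with $D=\rho W$, $\mathbf m=\rho hW^2\mathbf v+|\mathbf B|^2\mathbf v-(\mathbf v\cdot\mathbf B)\mathbf B$, $E=\rho hW^2-p_{tot}+|\mathbf B|^2$. The admissible state set is $\mathcal G=\{\mathbf U(\mathbf V): \rho>0,\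 p>0,\ |\mathbf v|<1,\ \mathbf B\in\mathbb R^3\}$. Each $\mathbf U\in\mathcal G$ determines its primitive variables, and for $\mathbf U\in\mathcal G$ and $i\in\{1,2,3\}$ the flux is $$\mathbf F_i(\mathbf U)=\Big(Dv_i,\ v_i\mathbf m-B_i\big(W^{-2}\mathbf B+(\mathbf v\cdot\mathbf B)\mathbf v\big)+p_{tot}\mathbf e_i,\ v_i\mathbf B-B_i\mathbf v,\ m_i\Big)^\top,$$ with $\mathbf e_i$ the $i$-th row of the $3\times3$ identity matrix. *)

theory Defs
  imports "HOL-Analysis.Analysis"
begin

type_synonym primitive = "real \<times> (real^3) \<times> (real^3) \<times> real"     \<comment> \<open>\<open>(\<rho>, v, B, p)\<close>\<close>
type_synonym conservative = "real \<times> (real^3) \<times> (real^3) \<times> real"  \<comment> \<open>\<open>(D, m, B, E)\<close>; as a real vector space this is \<open>\<real>\<^sup>8\<close>\<close>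

definition lorentz :: "real^3 \<Rightarrow> real" where
  "lorentz v = 1 / sqrt (1 - (norm v)\<^sup>2)"

definition internal_energy :: "real \<Rightarrow> real \<Rightarrow> real \<Rightarrow> real" where
  "internal_energy \<Gamma> \<rho> p = p / ((\<Gamma> - 1) * \<rho>)"

definition enthalpy :: "real \<Rightarrow> real \<Rightarrow> real \<Rightarrow> real" where
  "enthalpy \<Gamma> \<rho> p = 1 + internal_energy \<Gamma> \<rho> p + p / \<rho>"

definition mag_pressure :: "real^3 \<Rightarrow> real^3 \<Rightarrow> real" where
  "mag_pressure v B = 1/2 * (1 / (lorentz v)\<^sup>2 * (norm B)\<^sup>2 + (v \<bullet> B)\<^sup>2)"

definition total_pressure :: "real^3 \<Rightarrow> real^3 \<Rightarrow> real \<Rightarrow> real" where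
  "total_pressure v B p = p + mag_pressure v B"

fun cons_of_prim :: "real \<Rightarrow> primitive \<Rightarrow> conservative" where
  "cons_of_prim \<Gamma> (\<rho>, v, B, p) =
     (\<rho> * lorentz v,
      (\<rho> * enthalpy \<Gamma> \<rho> p * (lorentz v)\<^sup>2) *\<^sub>R v + (norm B)\<^sup>2 *\<^sub>R v - (v \<bullet> B) *\<^sub>R B,
      B,
      \<rho> * enthalpy \<Gamma> \<rho> p * (lorentz v)\<^sup>2 - total_pressure v B p + (norm B)\<^sup>2)"

definition admissible_prim :: "primitive set" where
  "admissible_prim = {(\<rho>, v, B, p). \<rho> > 0 \<and> p > 0 \<and> norm v < 1}"

definition admissible_states :: "real \<Rightarrow> conservative set" where
  "admissible_states \<Gamma> = cons_of_prim \<Gamma> ` admissible_prim"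

text \<open>
  A state in \<open>admissible_states \<Gamma>\<close> with \<open>1 < \<Gamma> \<le> 2\<close> has exactly one preimage in
  \<open>admissible_prim\<close>, so \<open>prim_of_cons\<close> is the recovery of the primitive variables there.
  Outside \<open>admissible_states \<Gamma>\<close> its value is arbitrary.
\<close>
definition prim_of_cons :: "real \<Rightarrow> conservative \<Rightarrow> primitive" where
  "prim_of_cons \<Gamma> = inv_into admissible_prim (cons_of_prim \<Gamma>)"

definition flux :: "real \<Rightarrow> 3 \<Rightarrow> conservative \<Rightarrow> conservative" where
  "flux \<Gamma> i U =
     (case U of (D, m, _, _) \<Rightarrow> case prim_of_cons \<Gamma> U of (\<rho>, v, B, p) \<Rightarrow>
       (D * v $ i,
        (v $ i) *\<^sub>R m - (B $ i) *\<^sub>R ((1 / (lorentz v)\<^sup>2) *\<^sub>R B + (v \<bullet> B) *\<^sub>R v)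
          + total_pressure v B p *\<^sub>R axis i 1,
        (v $ i) *\<^sub>R B - (B $ i) *\<^sub>R v,
        m $ i))"

end

theory Submission
  imports Defs
begin

text \<open>
  Membership in \<open>admissible_states\<close> is a nonlinear condition, defined through primitive variables that
  are recovered from \<open>U\<close> by solving a nonlinear equation.  The proof replaces it by a family of conditions that are
  affine in \<open>U\<close>, so that averaging two states becomes harmless.  For an auxiliary velocity \<open>w\<close>
  with \<open>norm w < 1\<close> and an auxiliary field \<open>C\<close>, let \<open>observer_energy w C U\<close> be the pairing of \<open>U\<close> with
  \<open>(- 1 / W, - w, - b, 1)\<close>, where \<open>W = lorentz w\<close> and \<open>b = C / W\<^sup>2 + (w \<bullet> C) w\<close>.

  A state with \<open>D > 0\<close> and \<open>observer_energy w C U + magnetic_energy w C > 0\<close> for all such \<open>w\<close> and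
  \<open>C = B\<close> is admissible (\<open>admissible_if_observer_energy_pos\<close>).  Indeed, for given \<open>D\<close>, \<open>m\<close>, \<open>B\<close> the candidate
  primitive states form a curve parametrised by \<open>\<xi> = \<rho> h W\<^sup>2\<close>.  It contains a pressureless state
  \<open>\<xi>\<^sub>0\<close>; taking for \<open>w\<close> the velocity of that state, the hypothesis says exactly that
  \<open>E\<close> exceeds its energy.  Beyond \<open>\<xi>\<^sub>0\<close> the pressure is positive and the energy is unbounded,
  so the intermediate value theorem yields a state with energy \<open>E\<close>.

  For a single state \<open>U\<close> with flux \<open>F\<close> the corresponding inequality carries corrections that are
  odd in the coefficient of the flux (\<open>flux_energy_pos\<close>): if \<open>\<bar>\<theta>\<bar> \<le> 1\<close> and \<open>F\<close> is the
  flux in the direction of a unit vector \<open>n\<close>, then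
  \<open>observer_energy w C (U + \<theta> F) + magnetic_energy w C * (1 + \<theta> (w \<bullet> n)) - \<theta> (B \<bullet> n) (w \<bullet> C) > 0\<close>.
  Adding the instances \<open>\<theta> = - 1 / \<alpha>\<close> and \<open>\<theta> = 1 / \<alpha>\<close> cancels these corrections, the last one
  precisely because both states have the same normal field \<open>B \<bullet> n\<close>.

  The expression is affine in \<open>\<theta>\<close>, so only \<open>\<theta> = \<plusminus> 1\<close> matters: the energy current is contracted with
  a null direction.  There the fluid part is positive because \<open>\<Gamma> / (\<Gamma> - 1) \<ge> 2\<close> dominates a Doppler
  factor (\<open>fluid_light_front_pos\<close>), and the magnetic part is, up to a positive factor, a positive
  semidefinite form plus a Gram determinant (\<open>magnetic_light_front_nonneg\<close>).
\<close>

section \<open>Energy seen by an observer\<close>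

text \<open>
  For a fluid of velocity \<open>w\<close> carrying the field \<open>C\<close>, the vector paired with \<open>B\<close> is the spatial part
  of the comoving magnetic four-vector, divided by the Lorentz factor of \<open>w\<close>.
\<close>
definition observer_energy :: "real^3 \<Rightarrow> real^3 \<Rightarrow> conservative \<Rightarrow> real" where
  "observer_energy w C = (\<lambda>(D, m, B, E).
     E - sqrt (1 - (norm w)\<^sup>2) * D - w \<bullet> m
       - ((1 - (norm w)\<^sup>2) *\<^sub>R C + (w \<bullet> C) *\<^sub>R w) \<bullet> B)"

lemma linear_observer_energy: "linear (observer_energy w C)"
  unfolding observer_energy_def
  by (rule linearI) (auto simp: algebra_simps inner_simps)

text \<open>
  The polynomial form of \<open>mag_pressure\<close>: free of Lorentz factors, it is meaningful for every velocity
  and, for \<open>norm v \<le> 1\<close>, is a positive semidefinite quadratic form in the field.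
\<close>
definition magnetic_energy :: "real^3 \<Rightarrow> real^3 \<Rightarrow> real" where
  "magnetic_energy v B = 1/2 * ((1 - v \<bullet> v) * (B \<bullet> B) + (v \<bullet> B)\<^sup>2)"

text \<open>
  The flux through a surface with normal \<open>n\<close>, as a function of primitive variables.  Being linear in
  \<open>n\<close>, it turns a change of sign in front of the flux into the reflection of \<open>n\<close>.
\<close>
definition directional_flux :: "real \<Rightarrow> real^3 \<Rightarrow> primitive \<Rightarrow> conservative" where
  "directional_flux \<Gamma> n = (\<lambda>(\<rho>, v, B, p). case cons_of_prim \<Gamma> (\<rho>, v, B, p) of (D, m, _, _) \<Rightarrow>
     (D * (v \<bullet> n),
      (v \<bullet> n) *\<^sub>R m - (B \<bullet> n) *\<^sub>R ((1 - (norm v)\<^sup>2) *\<^sub>R B + (v \<bullet> B) *\<^sub>R v)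
        + total_pressure v B p *\<^sub>R n,
      (v \<bullet> n) *\<^sub>R B - (B \<bullet> n) *\<^sub>R v,
      m \<bullet> n))"

lemma linear_directional_flux: "linear (\<lambda>n. directional_flux \<Gamma> n V)"
  unfolding directional_flux_def
  by (rule linearI) (auto simp: algebra_simps inner_simps split: prod.splits)

lemma inverse_lorentz_sq: "norm v < 1 \<Longrightarrow> 1 / (lorentz v)\<^sup>2 = 1 - (norm v)\<^sup>2"
  by (simp add: lorentz_def power_divide abs_square_le_1 less_imp_le)

lemma mag_pressure_eq: "norm v < 1 \<Longrightarrow> mag_pressure v B = magnetic_energy v B"
  unfolding mag_pressure_def inverse_lorentz_sq magnetic_energy_def power2_norm_eq_inner ..

text \<open>
  Whichever preimage \<open>prim_of_cons\<close> selects is admissible and maps back to \<open>U\<close>; it serves as \<open>V\<close>.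
\<close>
lemma flux_eq_directional_flux:
  assumes "U \<in> admissible_states \<Gamma>"
  obtains V where "V \<in> admissible_prim" "cons_of_prim \<Gamma> V = U"
    and "flux \<Gamma> i U = directional_flux \<Gamma> (axis i 1) V"
proof -
  let ?V = "prim_of_cons \<Gamma> U"
  have V: "?V \<in> admissible_prim" "cons_of_prim \<Gamma> ?V = U"
    using assms unfolding prim_of_cons_def admissible_states_def
    by (auto intro: inv_into_into f_inv_into_f)
  obtain \<rho> v B p where eq: "?V = (\<rho>, v, B, p)" by (cases ?V)
  have v: "norm v < 1" using V(1) eq by (simp add: admissible_prim_def)
  obtain D m B' E where U: "U = (D, m, B', E)" by (cases U)
  have "flux \<Gamma> i U = directional_flux \<Gamma> (axis i 1) ?V"
    using V(2) unfolding eq U directional_flux_def flux_def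
    using eq U inverse_lorentz_sq[OF v]
    by (auto simp: inner_axis)
  with V show ?thesis by (rule that)
qed

section \<open>Positivity of the light-front energy\<close>

text \<open>
  The Gram determinant of three vectors in space is the square of the determinant they form.
\<close>
lemma gram_determinant_nonneg:
  fixes x y z :: "real^3"
  shows "0 \<le> (x \<bullet> x) * (y \<bullet> y) * (z \<bullet> z) + 2 * (x \<bullet> y) * (y \<bullet> z) * (x \<bullet> z)
     - (x \<bullet> x) * (y \<bullet> z)\<^sup>2 - (y \<bullet> y) * (x \<bullet> z)\<^sup>2 - (z \<bullet> z) * (x \<bullet> y)\<^sup>2"
    (is "0 \<le> ?G")
proof -
  have "?G = (x$1 * (y$2 * z$3 - y$3 * z$2) - x$2 * (y$1 * z$3 - y$3 * z$1)
      + x$3 * (y$1 * z$2 - y$2 * z$1))\<^sup>2"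
    unfolding inner_vec_def inner_real_def sum_3 by algebra
  then show ?thesis by simp
qed

text \<open>
  Four vectors in space are linearly dependent, so their Gram determinant vanishes.
\<close>
lemma gram_determinant_4_eq_0:
  fixes x y z u :: "real^3"
  shows "(x \<bullet> x) * (y \<bullet> y) * (z \<bullet> z) * (u \<bullet> u)
     - (x \<bullet> x) * (y \<bullet> y) * (z \<bullet> u)\<^sup>2 - (x \<bullet> x) * (z \<bullet> z) * (y \<bullet> u)\<^sup>2
     - (x \<bullet> x) * (u \<bullet> u) * (y \<bullet> z)\<^sup>2 - (y \<bullet> y) * (z \<bullet> z) * (x \<bullet> u)\<^sup>2
     - (y \<bullet> y) * (u \<bullet> u) * (x \<bullet> z)\<^sup>2 - (z \<bullet> z) * (u \<bullet> u) * (x \<bullet> y)\<^sup>2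
     + 2 * (x \<bullet> x) * (y \<bullet> z) * (y \<bullet> u) * (z \<bullet> u)
     + 2 * (y \<bullet> y) * (x \<bullet> z) * (x \<bullet> u) * (z \<bullet> u)
     + 2 * (z \<bullet> z) * (x \<bullet> y) * (x \<bullet> u) * (y \<bullet> u)
     + 2 * (u \<bullet> u) * (x \<bullet> y) * (x \<bullet> z) * (y \<bullet> z)
     + (x \<bullet> y)\<^sup>2 * (z \<bullet> u)\<^sup>2 + (x \<bullet> z)\<^sup>2 * (y \<bullet> u)\<^sup>2 + (x \<bullet> u)\<^sup>2 * (y \<bullet> z)\<^sup>2
     - 2 * (x \<bullet> y) * (x \<bullet> z) * (y \<bullet> u) * (z \<bullet> u)
     - 2 * (x \<bullet> y) * (x \<bullet> u) * (y \<bullet> z) * (z \<bullet> u)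
     - 2 * (x \<bullet> z) * (x \<bullet> u) * (y \<bullet> z) * (y \<bullet> u) = 0"
  unfolding inner_vec_def inner_real_def sum_3 by algebra

lemma magnetic_energy_nonneg: "norm v \<le> 1 \<Longrightarrow> 0 \<le> magnetic_energy v B"
  by (simp add: magnetic_energy_def power2_norm_eq_inner[symmetric] abs_square_le_1)

text \<open>
  The expression is a quadratic form in \<open>C\<close> whose leading part is \<open>1 + w \<bullet> n\<close> times
  \<open>magnetic_energy w C\<close>.  Since \<open>w\<close> is fixed by the matrix \<open>(1 - w \<bullet> w) I + w w\<^sup>T\<close> of that
  form, the linear terms, including \<open>(B \<bullet> n) (w \<bullet> C)\<close>, can be absorbed by completing the square, with
  centre \<open>((1 + v \<bullet> n) B + (B \<bullet> n) (w - v)) / (1 + w \<bullet> n)\<close>.  The remainder is free of \<open>C\<close>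
  and equals, up to a positive factor, the squared determinant of \<open>w - v\<close>, \<open>B\<close>, \<open>v + n\<close>.  In spacetime
  this is, up to sign, the determinant of the four-vectors \<open>(1, v)\<close>, \<open>(1, w)\<close>, \<open>(0, B)\<close> and the null vector
  \<open>(1, - n)\<close>.
\<close>
lemma magnetic_light_front_nonneg:
  fixes n v w B C :: "real^3"
  assumes n: "norm n = 1" and w: "norm w < 1"
  defines "m \<equiv> (B \<bullet> B) *\<^sub>R v - (v \<bullet> B) *\<^sub>R B"
  shows "0 \<le> B \<bullet> B - magnetic_energy v B + m \<bullet> n
    - w \<bullet> ((1 + v \<bullet> n) *\<^sub>R m - (B \<bullet> n) *\<^sub>R ((1 - v \<bullet> v) *\<^sub>R B + (v \<bullet> B) *\<^sub>R v)
           + magnetic_energy v B *\<^sub>R n)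
    - ((1 - w \<bullet> w) *\<^sub>R C + (w \<bullet> C) *\<^sub>R w) \<bullet> ((1 + v \<bullet> n) *\<^sub>R B - (B \<bullet> n) *\<^sub>R v)
    + magnetic_energy w C * (1 + w \<bullet> n) - (B \<bullet> n) * (w \<bullet> C)" (is "0 \<le> ?Q")
proof -
  define Y where "Y = (1 + w \<bullet> n) *\<^sub>R C - (1 + v \<bullet> n) *\<^sub>R B - (B \<bullet> n) *\<^sub>R (w - v)"
  define x where "x = w - v"
  define z where "z = v + n"
  let ?G = "(x \<bullet> x) * (B \<bullet> B) * (z \<bullet> z) + 2 * (x \<bullet> B) * (B \<bullet> z) * (x \<bullet> z)
     - (x \<bullet> x) * (B \<bullet> z)\<^sup>2 - (B \<bullet> B) * (x \<bullet> z)\<^sup>2 - (z \<bullet> z) * (x \<bullet> B)\<^sup>2"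
  have n1: "n \<bullet> n = 1" using n by (simp add: norm_eq_1)
  \<comment> \<open>Expanded into inner products, the two sides differ by the Gram determinant of
    \<open>n\<close>, \<open>v\<close>, \<open>w\<close>, \<open>B\<close>; this is where the dimension of space enters.\<close>
  have sq: "2 * (1 + w \<bullet> n) * ?Q = 2 * magnetic_energy w Y + ?G"
    using gram_determinant_4_eq_0[of n v w B]
    unfolding magnetic_energy_def m_def Y_def x_def z_def
    by (simp add: inner_simps inner_commute n1 algebra_simps power2_eq_square
        add_divide_distrib diff_divide_distrib)
  have "\<bar>w \<bullet> n\<bar> < 1" using Cauchy_Schwarz_ineq2[of w n] n w by simp
  then have "0 < 2 * (1 + w \<bullet> n)" by (simp add: abs_less_iff)
  moreover have "0 \<le> 2 * (1 + w \<bullet> n) * ?Q"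
    unfolding sq using magnetic_energy_nonneg[of w Y] w gram_determinant_nonneg[of x B z] by simp
  ultimately show ?thesis by (simp add: zero_le_mult_iff)
qed

text \<open>
  In the rest frame of \<open>v\<close> this says that the frequency of a light ray seen by an observer with Lorentz
  factor \<open>\<gamma>\<close> is less than \<open>2 \<gamma>\<close> times its rest-frame frequency.  The inequality is affine in \<open>w\<close>,
  and the vector \<open>y\<close> of its linear coefficients has norm exactly equal to the constant term
  \<open>(norm (v + n))\<^sup>2\<close>, so it becomes an equality only on the unit sphere.
\<close>
lemma doppler_bound:
  fixes n v w :: "real^3"
  assumes n: "norm n = 1" and v: "norm v < 1" and w: "norm w < 1"
  shows "(1 - v \<bullet> v) * (1 + w \<bullet> n) < 2 * (1 + v \<bullet> n) * (1 - v \<bullet> w)"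
proof -
  define y where "y = (2 * (1 + v \<bullet> n)) *\<^sub>R v + (1 - v \<bullet> v) *\<^sub>R n"
  define q where "q = (norm (v + n))\<^sup>2"
  have n1: "n \<bullet> n = 1" using n by (simp add: norm_eq_1)
  have q: "q = v \<bullet> v + 2 * (v \<bullet> n) + 1"
    unfolding q_def power2_norm_eq_inner by (simp add: inner_simps n1 inner_commute)
  have "v + n \<noteq> 0" using n v by (metis add_eq_0_iff less_irrefl norm_minus_cancel)
  then have qpos: "0 < q" by (simp add: q_def)
  have "(norm y)\<^sup>2 = q\<^sup>2"
    unfolding q unfolding y_def power2_norm_eq_inner
    by (simp add: inner_simps n1 inner_commute algebra_simps power2_eq_square)
  then have y: "norm y = q" using qpos by (simp add: power2_eq_iff_nonneg)
  have "w \<bullet> y \<le> norm w * q" using norm_cauchy_schwarz[of w y] y by simp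
  also have "\<dots> < q" using w qpos by simp
  finally show ?thesis
    by (simp add: q y_def inner_simps inner_commute algebra_simps)
qed

text \<open>
  The relative Lorentz factor of two observers is at least one.
\<close>
lemma relative_lorentz_bound:
  fixes v w :: "real^3"
  assumes v: "norm v < 1" and w: "norm w < 1"
  shows "sqrt (1 - v \<bullet> v) * sqrt (1 - w \<bullet> w) \<le> 1 - v \<bullet> w"
proof -
  have "v \<bullet> w \<le> norm v * norm w" by (rule norm_cauchy_schwarz)
  moreover have "norm v * norm w \<le> 1" using v w by (simp add: mult_le_one less_imp_le)
  ultimately have vw: "(1 - norm v * norm w)\<^sup>2 \<le> (1 - v \<bullet> w)\<^sup>2"
    by (intro power_mono) auto
  have "(1 - v \<bullet> v) * (1 - w \<bullet> w) \<le> (1 - norm v * norm w)\<^sup>2"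
    using zero_le_power2[of "norm v - norm w"]
    unfolding power2_norm_eq_inner[symmetric] by (simp add: power2_eq_square algebra_simps)
  with vw have "sqrt ((1 - v \<bullet> v) * (1 - w \<bullet> w)) \<le> sqrt ((1 - v \<bullet> w)\<^sup>2)"
    by (intro real_sqrt_le_mono) linarith
  moreover have "0 \<le> 1 - v \<bullet> w"
    using \<open>v \<bullet> w \<le> norm v * norm w\<close> \<open>norm v * norm w \<le> 1\<close> by linarith
  ultimately show ?thesis by (simp add: real_sqrt_mult)
qed

text \<open>
  Splitting \<open>\<rho> h = \<rho> + \<Gamma> / (\<Gamma> - 1) p\<close>, the mass terms are controlled by \<open>relative_lorentz_bound\<close>.
  The condition \<open>\<Gamma> \<le> 2\<close> makes the coefficient of \<open>p\<close> at least \<open>2\<close>, which is the constant in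
  \<open>doppler_bound\<close>.  Strictness comes from \<open>p > 0\<close>.
\<close>
lemma fluid_light_front_pos:
  fixes n v w :: "real^3"
  assumes \<Gamma>: "1 < \<Gamma>" "\<Gamma> \<le> 2" and \<rho>: "0 < \<rho>" and p: "0 < p"
    and n: "norm n = 1" and v: "norm v < 1" and w: "norm w < 1"
  shows "0 < \<rho> * enthalpy \<Gamma> \<rho> p * (lorentz v)\<^sup>2 * (1 + v \<bullet> n) * (1 - v \<bullet> w)
     - p * (1 + w \<bullet> n) - sqrt (1 - w \<bullet> w) * (\<rho> * lorentz v) * (1 + v \<bullet> n)"
proof -
  define r where "r = sqrt (1 - v \<bullet> v)"
  define A where "A = 1 + v \<bullet> n"
  define g where "g = 1 - v \<bullet> w"
  have v2: "v \<bullet> v < 1" using v by (simp add: power2_norm_eq_inner[symmetric] abs_square_less_1)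
  then have r: "0 < r" "r\<^sup>2 = 1 - v \<bullet> v" by (simp_all add: r_def)
  have W: "lorentz v = 1 / r" by (simp add: lorentz_def r_def power2_norm_eq_inner)
  have "\<bar>v \<bullet> n\<bar> < 1" "\<bar>v \<bullet> w\<bar> \<le> norm v * norm w"
    using Cauchy_Schwarz_ineq2[of v n] Cauchy_Schwarz_ineq2[of v w] n v by simp_all
  moreover have "norm v * norm w < 1"
    using mult_strict_mono[of "norm v" 1 "norm w" 1] v w by simp
  ultimately have A: "0 < A" and g: "0 < g" by (auto simp: A_def g_def)
  have rw: "r * sqrt (1 - w \<bullet> w) \<le> g"
    using relative_lorentz_bound[OF v w] by (simp add: r_def g_def)
  have dop: "r\<^sup>2 * (1 + w \<bullet> n) < 2 * A * g"
    using doppler_bound[OF n v w] by (simp add: r A_def g_def)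
  have h: "\<rho> * enthalpy \<Gamma> \<rho> p = \<rho> + \<Gamma> / (\<Gamma> - 1) * p"
    using \<rho> \<Gamma> by (simp add: enthalpy_def internal_energy_def field_simps)
  have "2 \<le> \<Gamma> / (\<Gamma> - 1)" using \<Gamma> by (simp add: field_simps)
  then have "2 * p \<le> \<Gamma> / (\<Gamma> - 1) * p" using p by (intro mult_right_mono) auto
  then have "\<rho> + 2 * p \<le> \<rho> * enthalpy \<Gamma> \<rho> p" unfolding h by simp
  then have "(\<rho> + 2 * p) * (A * g) \<le> \<rho> * enthalpy \<Gamma> \<rho> p * (A * g)"
    using A g by (intro mult_right_mono) auto
  moreover have "(r * sqrt (1 - w \<bullet> w)) * (\<rho> * A) \<le> g * (\<rho> * A)"
    using rw \<rho> A by (intro mult_right_mono) auto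
  moreover have "p * (r\<^sup>2 * (1 + w \<bullet> n)) < p * (2 * A * g)"
    using dop p by simp
  ultimately have "0 < \<rho> * enthalpy \<Gamma> \<rho> p * (A * g) - p * (r\<^sup>2 * (1 + w \<bullet> n))
      - (r * sqrt (1 - w \<bullet> w)) * (\<rho> * A)"
    by (simp add: algebra_simps)
  also have "\<dots> = r\<^sup>2 * (\<rho> * enthalpy \<Gamma> \<rho> p * (1/r)\<^sup>2 * A * g
      - p * (1 + w \<bullet> n) - sqrt (1 - w \<bullet> w) * (\<rho> * (1/r)) * A)"
    using r(1) by (simp add: field_simps power2_eq_square)
  finally show ?thesis
    unfolding W A_def[symmetric] g_def[symmetric] by (simp add: zero_less_mult_iff)
qed

lemma light_front_energy_pos:
  assumes \<Gamma>: "1 < \<Gamma>" "\<Gamma> \<le> 2" and V: "(\<rho>, v, B, p) \<in> admissible_prim"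
    and n: "norm n = 1" and w: "norm w < 1"
  shows "0 < observer_energy w C (cons_of_prim \<Gamma> (\<rho>, v, B, p) + directional_flux \<Gamma> n (\<rho>, v, B, p))
     + magnetic_energy w C * (1 + w \<bullet> n) - (B \<bullet> n) * (w \<bullet> C)"
proof -
  have \<rho>: "0 < \<rho>" and p: "0 < p" and v: "norm v < 1"
    using V by (auto simp: admissible_prim_def)
  show ?thesis
    using fluid_light_front_pos[OF \<Gamma> \<rho> p n v w] magnetic_light_front_nonneg[OF n w, of B v C]
    by (simp add: observer_energy_def directional_flux_def total_pressure_def mag_pressure_eq[OF v]
        power2_norm_eq_inner inner_simps inner_commute algebra_simps)
qed

text \<open>
  The expression has the form \<open>a + \<theta> b\<close>; its values at \<open>\<theta> = 1\<close> and \<open>\<theta> = - 1\<close> are the light-front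
  energies for the normals \<open>n\<close> and \<open>- n\<close>.
\<close>
lemma flux_energy_pos:
  assumes \<Gamma>: "1 < \<Gamma>" "\<Gamma> \<le> 2" and V: "(\<rho>, v, B, p) \<in> admissible_prim"
    and n: "norm n = 1" and w: "norm w < 1" and \<theta>: "\<bar>\<theta>\<bar> \<le> 1"
  shows "0 < observer_energy w C
       (cons_of_prim \<Gamma> (\<rho>, v, B, p) + \<theta> *\<^sub>R directional_flux \<Gamma> n (\<rho>, v, B, p))
     + magnetic_energy w C * (1 + \<theta> * (w \<bullet> n)) - \<theta> * ((B \<bullet> n) * (w \<bullet> C))"
proof -
  define U where "U = observer_energy w C (cons_of_prim \<Gamma> (\<rho>, v, B, p))"
  define F where "F = observer_energy w C (directional_flux \<Gamma> n (\<rho>, v, B, p))"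
  define a where "a = U + magnetic_energy w C"
  define b where "b = F + magnetic_energy w C * (w \<bullet> n) - (B \<bullet> n) * (w \<bullet> C)"
  note lin = linear_add[OF linear_observer_energy] linear_scale[OF linear_observer_energy]
    linear_diff[OF linear_observer_energy] linear_neg[OF linear_directional_flux]
  have "0 < a + b"
    using light_front_energy_pos[OF \<Gamma> V n w, of C]
    by (simp add: lin a_def b_def U_def F_def algebra_simps del: cons_of_prim.simps)
  moreover have "0 < a - b"
    using light_front_energy_pos[OF \<Gamma> V _ w, of "- n" C] n
    by (simp add: lin a_def b_def U_def F_def algebra_simps del: cons_of_prim.simps)
  ultimately have "\<bar>b\<bar> < a" by linarith
  moreover have "\<bar>\<theta> * b\<bar> \<le> \<bar>b\<bar>"
    using \<theta> by (simp add: abs_mult mult_left_le_one_le)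
  ultimately have "0 < a + \<theta> * b" by linarith
  then show ?thesis
    by (simp add: lin a_def b_def U_def F_def algebra_simps del: cons_of_prim.simps)
qed

section \<open>Recovery of the primitive variables\<close>

text \<open>
  The momentum equation \<open>m = (\<xi> + B \<bullet> B) v - (v \<bullet> B) B\<close> with \<open>\<xi> = \<rho> h W\<^sup>2\<close> prescribed, solved for
  \<open>v\<close>: taking its inner product with \<open>B\<close> gives \<open>m \<bullet> B = \<xi> (v \<bullet> B)\<close>, after which it is linear in
  \<open>v\<close>.
\<close>
definition momentum_velocity :: "real^3 \<Rightarrow> real^3 \<Rightarrow> real \<Rightarrow> real^3" where
  "momentum_velocity m B \<xi> = (1 / (\<xi> + B \<bullet> B)) *\<^sub>R (m + (m \<bullet> B / \<xi>) *\<^sub>R B)"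

lemma momentum_velocity_inner:
  assumes "0 < \<xi>"
  shows "momentum_velocity m B \<xi> \<bullet> B = m \<bullet> B / \<xi>"
proof -
  have pos: "0 < \<xi> + B \<bullet> B" using assms by (simp add: add_pos_nonneg)
  have "momentum_velocity m B \<xi> \<bullet> B = (m \<bullet> B + m \<bullet> B / \<xi> * (B \<bullet> B)) / (\<xi> + B \<bullet> B)"
    by (simp add: momentum_velocity_def inner_simps)
  also have "m \<bullet> B + m \<bullet> B / \<xi> * (B \<bullet> B) = m \<bullet> B / \<xi> * (\<xi> + B \<bullet> B)"
    using assms by (simp add: distrib_left)
  finally show ?thesis using pos by simp
qed

lemma momentum_velocity_solves:
  assumes "0 < \<xi>"
  shows "(\<xi> + B \<bullet> B) *\<^sub>R momentum_velocity m B \<xi> - (momentum_velocity m B \<xi> \<bullet> B) *\<^sub>R B = m"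
proof -
  have "0 < \<xi> + B \<bullet> B" using assms by (simp add: add_pos_nonneg)
  then show ?thesis
    unfolding momentum_velocity_inner[OF assms] by (simp add: momentum_velocity_def)
qed

lemma momentum_velocity_sq:
  assumes "0 < \<xi>"
  shows "(norm (momentum_velocity m B \<xi>))\<^sup>2 =
    (m \<bullet> m + 2 * (m \<bullet> B)\<^sup>2 / \<xi> + (m \<bullet> B)\<^sup>2 * (B \<bullet> B) / \<xi>\<^sup>2) / (\<xi> + B \<bullet> B)\<^sup>2"
proof -
  have "(norm (m + (m \<bullet> B / \<xi>) *\<^sub>R B))\<^sup>2
      = m \<bullet> m + 2 * (m \<bullet> B)\<^sup>2 / \<xi> + (m \<bullet> B)\<^sup>2 * (B \<bullet> B) / \<xi>\<^sup>2"
    unfolding power2_norm_eq_inner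
    by (simp add: inner_simps inner_commute power2_eq_square algebra_simps)
  then show ?thesis
    by (simp add: momentum_velocity_def power_mult_distrib power_divide)
qed

lemma momentum_velocity_antimono:
  assumes "0 < \<xi>" "\<xi> \<le> \<eta>"
  shows "(norm (momentum_velocity m B \<eta>))\<^sup>2 \<le> (norm (momentum_velocity m B \<xi>))\<^sup>2"
proof -
  have "0 < \<eta>" using assms by simp
  show ?thesis
    unfolding momentum_velocity_sq[OF \<open>0 < \<xi>\<close>] momentum_velocity_sq[OF \<open>0 < \<eta>\<close>]
    using assms
    by (intro frac_le add_mono divide_left_mono power_mono mult_pos_pos zero_less_power
        add_nonneg_nonneg add_pos_nonneg) auto
qed

lemma norm_momentum_velocity_le:
  assumes "0 < \<xi>"
  shows "norm (momentum_velocity m B \<xi>) \<le> norm m / \<xi>"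
proof -
  have pos: "0 < \<xi> + B \<bullet> B" using assms by (simp add: add_pos_nonneg)
  have "norm (m + (m \<bullet> B / \<xi>) *\<^sub>R B) \<le> norm m + \<bar>m \<bullet> B\<bar> / \<xi> * norm B"
    using norm_triangle_ineq[of m "(m \<bullet> B / \<xi>) *\<^sub>R B"] assms by simp
  also have "\<dots> \<le> norm m + (norm m * norm B) / \<xi> * norm B"
    using assms Cauchy_Schwarz_ineq2[of m B]
    by (intro add_left_mono mult_right_mono divide_right_mono) auto
  also have "\<dots> = norm m / \<xi> * (\<xi> + B \<bullet> B)"
    using assms by (simp add: field_simps power2_norm_eq_inner[symmetric] power2_eq_square)
  finally show ?thesis
    using pos by (simp add: momentum_velocity_def divide_le_eq)
qed

lemma continuous_on_momentum_velocity:
  assumes "\<And>\<xi>. \<xi> \<in> S \<Longrightarrow> 0 < \<xi>"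
  shows "continuous_on S (momentum_velocity m B)"
proof -
  have "\<xi> \<noteq> 0 \<and> \<xi> + B \<bullet> B \<noteq> 0" if "\<xi> \<in> S" for \<xi>
    using assms[OF that] inner_ge_zero[of B] by linarith
  then show ?thesis
    unfolding momentum_velocity_def[abs_def] by (intro continuous_intros) auto
qed

text \<open>
  A pressureless state has \<open>h = 1\<close>, hence \<open>\<xi> = D W\<close>, which is the equation solved here in squared
  form.  Squaring avoids deciding beforehand where the velocity is subluminal: the left-hand side is
  at most \<open>\<xi>\<^sup>2\<close> and, by \<open>norm_momentum_velocity_le\<close>, at least \<open>\<xi>\<^sup>2 - (norm m)\<^sup>2\<close>, so it
  passes through \<open>D\<^sup>2\<close> between \<open>D\<close> and \<open>D + norm m\<close>.
\<close>
lemma cold_state_exists: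
  fixes m B :: "real^3"
  assumes D: "0 < D"
  obtains \<xi> where "D \<le> \<xi>" "\<xi>\<^sup>2 * (1 - (norm (momentum_velocity m B \<xi>))\<^sup>2) = D\<^sup>2"
proof -
  let ?h = "\<lambda>\<xi>. \<xi>\<^sup>2 * (1 - (norm (momentum_velocity m B \<xi>))\<^sup>2)"
  let ?X = "D + norm m"
  have X: "0 < ?X" using D by (simp add: add_pos_nonneg)
  have "?h D \<le> D\<^sup>2 * 1" by (intro mult_left_mono) auto
  moreover have "D\<^sup>2 \<le> ?h ?X"
  proof -
    have "?X\<^sup>2 * (norm (momentum_velocity m B ?X))\<^sup>2 \<le> ?X\<^sup>2 * (norm m / ?X)\<^sup>2"
      by (intro mult_left_mono power_mono norm_momentum_velocity_le X) auto
    also have "\<dots> = (norm m)\<^sup>2" using X by (simp add: field_simps)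
    finally have "?X\<^sup>2 - (norm m)\<^sup>2 \<le> ?h ?X" by (simp add: right_diff_distrib)
    moreover have "D\<^sup>2 \<le> ?X\<^sup>2 - (norm m)\<^sup>2" using D by (simp add: power2_sum)
    ultimately show ?thesis by linarith
  qed
  moreover have "continuous_on {D..?X} ?h"
    by (intro continuous_intros continuous_on_momentum_velocity) (use D in auto)
  ultimately obtain \<xi> where "D \<le> \<xi>" "?h \<xi> = D\<^sup>2"
    using IVT'[of ?h D "D\<^sup>2" ?X] by auto
  then show ?thesis by (rule that)
qed

lemma magnetic_energy_le:
  assumes "norm v \<le> 1"
  shows "magnetic_energy v B \<le> (B \<bullet> B) / 2"
  using Cauchy_Schwarz_ineq[of v B] by (simp add: magnetic_energy_def algebra_simps)

text \<open>
  The functions \<open>press\<close> and \<open>en\<close> are the pressure and energy forced by \<open>D\<close>, \<open>m\<close>, \<open>B\<close> when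
  \<open>\<rho> h W\<^sup>2 = \<xi>\<close>.  The pressure vanishes at the cold state \<open>\<xi>0\<close> and is positive beyond it,
  because the speed does not increase with \<open>\<xi>\<close> and hence \<open>\<xi> > D W\<close> there.  The energy starts below \<open>E\<close>
  by \<open>pos\<close> at the cold velocity and grows at least like \<open>\<xi> / \<Gamma>\<close>.
\<close>
lemma admissible_if_observer_energy_pos:
  assumes \<Gamma>: "1 < \<Gamma>" and D: "0 < D"
    and pos: "\<And>w. norm w < 1 \<Longrightarrow> 0 < observer_energy w B (D, m, B, E) + magnetic_energy w B"
  shows "(D, m, B, E) \<in> admissible_states \<Gamma>"
proof -
  define vel where "vel = momentum_velocity m B"
  define \<kappa> where "\<kappa> = (\<Gamma> - 1) / \<Gamma>"
  define f where "f = (\<lambda>\<xi>. 1 - (norm (vel \<xi>))\<^sup>2)"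
  define press where "press = (\<lambda>\<xi>. \<kappa> * (\<xi> * f \<xi> - D * sqrt (f \<xi>)))"
  define en where "en = (\<lambda>\<xi>. \<xi> - press \<xi> - magnetic_energy (vel \<xi>) B + B \<bullet> B)"
  have \<kappa>: "0 < \<kappa>" using \<Gamma> by (simp add: \<kappa>_def)
  obtain \<xi>0 where \<xi>0: "D \<le> \<xi>0" "\<xi>0\<^sup>2 * f \<xi>0 = D\<^sup>2"
    using cold_state_exists[OF D, of m B] unfolding f_def vel_def by blast
  have \<xi>0_pos: "0 < \<xi>0" using \<xi>0 D by simp
  have f0: "0 < f \<xi>0"
    using \<xi>0(2) D \<xi>0_pos by (metis zero_less_mult_pos zero_less_power)
  have f_mono: "f \<xi>0 \<le> f \<xi>" if "\<xi>0 \<le> \<xi>" for \<xi>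
    using momentum_velocity_antimono[OF \<xi>0_pos that, of m B] by (simp add: f_def vel_def)
  have subluminal: "norm (vel \<xi>) < 1" if "\<xi>0 \<le> \<xi>" for \<xi>
  proof -
    have "(norm (vel \<xi>))\<^sup>2 < 1" using f_mono[OF that] f0 unfolding f_def by linarith
    then show ?thesis by (simp add: abs_square_less_1)
  qed
  have sqrt0: "\<xi>0 * sqrt (f \<xi>0) = D"
    using \<xi>0(2) \<xi>0_pos f0 D
    by (metis abs_of_pos real_sqrt_abs real_sqrt_mult)
  have press0: "press \<xi>0 = 0"
    using sqrt0 f0 by (simp add: press_def) (metis less_imp_le mult.assoc real_sqrt_mult_self abs_of_pos)
  \<comment> \<open>With field \<open>B\<close> and the cold velocity, \<open>observer_energy + magnetic_energy\<close> is \<open>E\<close> minus the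
    energy of the cold state.\<close>
  have en0: "en \<xi>0 < E"
  proof -
    let ?w = "vel \<xi>0"
    have m: "m = (\<xi>0 + B \<bullet> B) *\<^sub>R ?w - (?w \<bullet> B) *\<^sub>R B"
      using momentum_velocity_solves[OF \<xi>0_pos, of B m] by (simp add: vel_def)
    have wm: "?w \<bullet> m = (\<xi>0 + B \<bullet> B) * (?w \<bullet> ?w) - (?w \<bullet> B)\<^sup>2"
      by (subst m) (simp add: inner_simps power2_eq_square)
    have "sqrt (f \<xi>0) * D = \<xi>0 * (sqrt (f \<xi>0) * sqrt (f \<xi>0))"
      by (simp flip: sqrt0)
    also have "\<dots> = \<xi>0 * (1 - ?w \<bullet> ?w)"
      using f0 by (simp add: f_def power2_norm_eq_inner)
    finally have rest: "sqrt (1 - ?w \<bullet> ?w) * D = \<xi>0 * (1 - ?w \<bullet> ?w)"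
      by (simp add: f_def power2_norm_eq_inner)
    have "0 < E - \<xi>0 * (1 - ?w \<bullet> ?w) - ((\<xi>0 + B \<bullet> B) * (?w \<bullet> ?w) - (?w \<bullet> B)\<^sup>2)
        - 2 * magnetic_energy ?w B + magnetic_energy ?w B"
      using pos[OF subluminal[OF order_refl]]
      unfolding observer_energy_def power2_norm_eq_inner case_prod_conv rest wm
      by (simp add: magnetic_energy_def inner_simps power2_eq_square algebra_simps
          add_divide_distrib diff_divide_distrib)
    then show ?thesis
      by (simp add: en_def press0 magnetic_energy_def algebra_simps
          add_divide_distrib diff_divide_distrib)
  qed
  have en_ge: "\<xi> / \<Gamma> \<le> en \<xi>" if "\<xi>0 \<le> \<xi>" for \<xi>
  proof -
    have xi: "0 < \<xi>" using that \<xi>0_pos by simp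
    have "0 < f \<xi>" using f_mono[OF that] f0 by linarith
    moreover have "f \<xi> \<le> 1" by (simp add: f_def)
    ultimately have "\<xi> * f \<xi> \<le> \<xi>" "0 \<le> D * sqrt (f \<xi>)" using xi D by (auto simp: mult_left_le)
    then have "press \<xi> \<le> \<kappa> * \<xi>"
      unfolding press_def using \<kappa> by (intro mult_left_mono) auto
    moreover have "magnetic_energy (vel \<xi>) B \<le> (B \<bullet> B) / 2"
      using subluminal[OF that] by (intro magnetic_energy_le) simp
    moreover have "\<xi> - \<kappa> * \<xi> = \<xi> / \<Gamma>" using \<Gamma> by (simp add: \<kappa>_def field_simps)
    moreover have "0 \<le> B \<bullet> B" by simp
    ultimately show ?thesis unfolding en_def by linarith
  qed
  \<comment> \<open>The second entry makes \<open>X / \<Gamma> \<ge> E\<close>.\<close>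
  define X where "X = max \<xi>0 (\<Gamma> * E)"
  have "E \<le> X / \<Gamma>" using \<Gamma> by (simp add: X_def le_divide_eq mult.commute)
  also have "\<dots> \<le> en X" by (intro en_ge) (simp add: X_def)
  finally have "E \<le> en X" .
  moreover have "continuous_on {\<xi>0..X} en"
    unfolding en_def press_def f_def magnetic_energy_def vel_def
    by (intro continuous_intros continuous_on_momentum_velocity) (use \<xi>0_pos in auto)
  moreover have "\<xi>0 \<le> X" by (simp add: X_def)
  ultimately obtain \<xi> where \<xi>: "\<xi>0 \<le> \<xi>" "en \<xi> = E"
    using IVT'[of en \<xi>0 E X] en0 by (meson less_imp_le)
  then have less: "\<xi>0 < \<xi>" using en0 by (metis less_le)
  then have \<xi>_pos: "0 < \<xi>" using \<xi>0_pos by simp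
  define r where "r = sqrt (f \<xi>)"
  have fx: "f \<xi>0 \<le> f \<xi>" "0 < f \<xi>" using f_mono[OF \<xi>(1)] f0 by auto
  have r: "0 < r" "r\<^sup>2 = f \<xi>" using fx by (auto simp: r_def)
  have "D \<le> \<xi>0 * r"
    using fx \<xi>0_pos by (simp add: r_def flip: sqrt0)
  also have "\<dots> < \<xi> * r" using less r by simp
  finally have "0 < \<kappa> * (r * (\<xi> * r - D))" using \<kappa> r by simp
  also have "\<dots> = press \<xi>"
    unfolding press_def r(2)[symmetric] r_def[symmetric] using r(1)
    by (simp add: algebra_simps power2_eq_square)
  finally have press: "0 < press \<xi>" .
  have lor: "lorentz (vel \<xi>) = 1 / r" by (simp add: lorentz_def r_def f_def)
  have sub: "norm (vel \<xi>) < 1" by (rule subluminal[OF \<xi>(1)])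
  have pk: "\<Gamma> * press \<xi> = (\<Gamma> - 1) * (\<xi> * r\<^sup>2 - D * r)"
    using \<Gamma> r(1) unfolding press_def r(2)[symmetric] \<kappa>_def by simp
  have "(D * r) * enthalpy \<Gamma> (D * r) (press \<xi>) = D * r + \<Gamma> * press \<xi> / (\<Gamma> - 1)"
    using D r \<Gamma> by (simp add: enthalpy_def internal_energy_def field_simps)
  also have "\<dots> = \<xi> * r\<^sup>2" using \<Gamma> by (simp add: pk)
  finally have h: "(D * r) * enthalpy \<Gamma> (D * r) (press \<xi>) * (lorentz (vel \<xi>))\<^sup>2 = \<xi>"
    using fx(2) by (simp add: lor power_divide r(2))
  have "cons_of_prim \<Gamma> (D * r, vel \<xi>, B, press \<xi>) = (D, m, B, E)"
    using momentum_velocity_solves[OF \<xi>_pos, of B m] \<xi>(2) r(1)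
    by (simp add: h total_pressure_def mag_pressure_eq[OF sub] en_def vel_def[symmetric]
        power2_norm_eq_inner scaleR_left_distrib) (simp add: lor)
  moreover have "(D * r, vel \<xi>, B, press \<xi>) \<in> admissible_prim"
    using D r press sub by (simp add: admissible_prim_def)
  ultimately show ?thesis unfolding admissible_states_def by (metis imageI)
qed

section \<open>The Lax-Friedrichs average\<close>

lemma density_of_flux_shift_pos:
  assumes V: "V \<in> admissible_prim" and n: "norm n = 1" and \<theta>: "\<bar>\<theta>\<bar> \<le> 1"
  shows "0 < fst (cons_of_prim \<Gamma> V + \<theta> *\<^sub>R directional_flux \<Gamma> n V)"
proof -
  obtain \<rho> v B p where eq: "V = (\<rho>, v, B, p)" by (cases V)
  have \<rho>: "0 < \<rho>" and v: "norm v < 1" using V by (auto simp: eq admissible_prim_def)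
  have "(norm v)\<^sup>2 < 1" using v by (simp add: abs_square_less_1)
  then have "0 < lorentz v" by (simp add: lorentz_def)
  moreover have "\<bar>\<theta> * (v \<bullet> n)\<bar> \<le> 1 * \<bar>v \<bullet> n\<bar>"
    unfolding abs_mult using \<theta> by (intro mult_right_mono) auto
  moreover have "\<bar>v \<bullet> n\<bar> < 1" using Cauchy_Schwarz_ineq2[of v n] n v by simp
  ultimately have "0 < (\<rho> * lorentz v) * (1 + \<theta> * (v \<bullet> n))" using \<rho> by simp
  then show ?thesis by (simp add: eq directional_flux_def algebra_simps)
qed

theorem theorem2p4:
  fixes \<Gamma> \<alpha> :: real and i :: 3
    and U\<^sub>t U\<^sub>h :: conservative
    and D\<^sub>t D\<^sub>h E\<^sub>t E\<^sub>h :: real and m\<^sub>t m\<^sub>h B\<^sub>t B\<^sub>h :: "real^3"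
  assumes "1 < \<Gamma>" and "\<Gamma> \<le> 2"
    and "U\<^sub>t = (D\<^sub>t, m\<^sub>t, B\<^sub>t, E\<^sub>t)" and "U\<^sub>t \<in> admissible_states \<Gamma>"
    and "U\<^sub>h = (D\<^sub>h, m\<^sub>h, B\<^sub>h, E\<^sub>h)" and "U\<^sub>h \<in> admissible_states \<Gamma>"
    and "B\<^sub>t $ i - B\<^sub>h $ i = 0"
    and "\<alpha> \<ge> 1"
  shows "(1/2) *\<^sub>R (U\<^sub>t - inverse \<alpha> *\<^sub>R flux \<Gamma> i U\<^sub>t + U\<^sub>h + inverse \<alpha> *\<^sub>R flux \<Gamma> i U\<^sub>h)
           \<in> admissible_states \<Gamma>"
proof -
  define n :: "real^3" where "n = axis i 1"
  have n: "norm n = 1" by (simp add: n_def)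
  define \<theta> where "\<theta> = inverse \<alpha>"
  have \<theta>: "\<bar>\<theta>\<bar> \<le> 1" "\<bar>- \<theta>\<bar> \<le> 1"
    using assms(8) by (simp_all add: \<theta>_def inverse_le_1_iff)
  obtain V\<^sub>t where Vt: "V\<^sub>t \<in> admissible_prim" "cons_of_prim \<Gamma> V\<^sub>t = U\<^sub>t"
      "flux \<Gamma> i U\<^sub>t = directional_flux \<Gamma> n V\<^sub>t"
    using flux_eq_directional_flux[OF assms(4)] unfolding n_def by blast
  obtain V\<^sub>h where Vh: "V\<^sub>h \<in> admissible_prim" "cons_of_prim \<Gamma> V\<^sub>h = U\<^sub>h"
      "flux \<Gamma> i U\<^sub>h = directional_flux \<Gamma> n V\<^sub>h"
    using flux_eq_directional_flux[OF assms(6)] unfolding n_def by blast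
  obtain \<rho>\<^sub>t v\<^sub>t p\<^sub>t where Vt_eq: "V\<^sub>t = (\<rho>\<^sub>t, v\<^sub>t, B\<^sub>t, p\<^sub>t)"
    using Vt(2) assms(3) by (cases V\<^sub>t) auto
  obtain \<rho>\<^sub>h v\<^sub>h p\<^sub>h where Vh_eq: "V\<^sub>h = (\<rho>\<^sub>h, v\<^sub>h, B\<^sub>h, p\<^sub>h)"
    using Vh(2) assms(5) by (cases V\<^sub>h) auto
  have Bn: "B\<^sub>t \<bullet> n = B\<^sub>h \<bullet> n" using assms(7) by (simp add: n_def inner_axis)
  define S\<^sub>t where "S\<^sub>t = U\<^sub>t + (- \<theta>) *\<^sub>R directional_flux \<Gamma> n V\<^sub>t"
  define S\<^sub>h where "S\<^sub>h = U\<^sub>h + \<theta> *\<^sub>R directional_flux \<Gamma> n V\<^sub>h"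
  have avg: "(1/2) *\<^sub>R (U\<^sub>t - inverse \<alpha> *\<^sub>R flux \<Gamma> i U\<^sub>t + U\<^sub>h + inverse \<alpha> *\<^sub>R flux \<Gamma> i U\<^sub>h)
      = (1/2) *\<^sub>R (S\<^sub>t + S\<^sub>h)"
    by (simp add: S\<^sub>t_def S\<^sub>h_def Vt(3) Vh(3) \<theta>_def algebra_simps)
  have energy: "0 < observer_energy w C ((1/2) *\<^sub>R (S\<^sub>t + S\<^sub>h)) + magnetic_energy w C"
    if w: "norm w < 1" for w C
  proof -
    have "0 < observer_energy w C S\<^sub>t + magnetic_energy w C * (1 + (- \<theta>) * (w \<bullet> n))
        - (- \<theta>) * ((B\<^sub>t \<bullet> n) * (w \<bullet> C))"
      using flux_energy_pos[OF assms(1,2) _ n w \<theta>(2), of \<rho>\<^sub>t v\<^sub>t B\<^sub>t p\<^sub>t C] Vt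
      unfolding S\<^sub>t_def Vt_eq by simp
    moreover have "0 < observer_energy w C S\<^sub>h + magnetic_energy w C * (1 + \<theta> * (w \<bullet> n))
        - \<theta> * ((B\<^sub>h \<bullet> n) * (w \<bullet> C))"
      using flux_energy_pos[OF assms(1,2) _ n w \<theta>(1), of \<rho>\<^sub>h v\<^sub>h B\<^sub>h p\<^sub>h C] Vh
      unfolding S\<^sub>h_def Vh_eq by simp
    ultimately show ?thesis
      by (simp add: linear_add[OF linear_observer_energy] linear_scale[OF linear_observer_energy]
          Bn algebra_simps)
  qed
  obtain D m B E where avg_eq: "(1/2) *\<^sub>R (S\<^sub>t + S\<^sub>h) = (D, m, B, E)"
    by (cases "(1/2) *\<^sub>R (S\<^sub>t + S\<^sub>h)")
  have "0 < fst S\<^sub>t" "0 < fst S\<^sub>h"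
    using density_of_flux_shift_pos[OF Vt(1) n \<theta>(2), of \<Gamma>]
      density_of_flux_shift_pos[OF Vh(1) n \<theta>(1), of \<Gamma>]
    by (simp_all add: S\<^sub>t_def S\<^sub>h_def Vt(2) Vh(2))
  moreover have "D = (1/2) * (fst S\<^sub>t + fst S\<^sub>h)"
    using arg_cong[OF avg_eq, of fst] by simp
  ultimately have "0 < D" by simp
  then show ?thesis
    unfolding avg avg_eq
    using energy unfolding avg_eq
    by (intro admissible_if_observer_energy_pos[OF assms(1)]) auto
qed

end
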